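(* Let $G=(V,E)$ be a directed graph with $V=[p]$ whose edge set contains all self-loops $i\to i$, $i\in[p]$. (i) If $G$ is simple, then the model $\mathcal{M}_{G,C}$ is globally identifiable for all $C\in\mathrm{PD}_p$. (ii) If $C\in\mathrm{PD}_p$ is diagonal, then the model $\mathcal{M}_{G,C}$ is globally identifiable if and only if $G$ is simple.
   Context: $[p]=\{1,\dots,p\}$, and $\mathrm{PD}_p$ is the cone of real symmetric positive definite $p\times p$ matrices. All directed graphs $G=(V,E)$ are assumed to contain all self-loops $i\to i$. $G$ is simple if there are no two distinct nodes $i,j$ with both $i\to j\in E$ and $j\to i\in E$. $\mathbb{R}^E$ is the space of real $p\times p$ matrices $M=(m_{ij})$ with $m_{ji}=0$ whenever $i\to j\notin E$; $\mathrm{Stab}(E)\subseteq\mathbb{R}^E$ is the subset of stable matrices (all eigenvalues have negative real part). For $C\in\mathrm{PD}_p$, the graphical continuous Lyapunov model is $\mathcal{M}_{G,C}=\{\Sigma\in\mathrm{PD}_p: M\Sigma+\Sigma M^\top=-C \text{ for some } M\in\mathbb{R}^E\}$. The map $\phi_{G,C}:\mathrm{Stab}(E)\to\mathrm{PD}_p$ sends $M$ to the unique $\Sigma$ solving $M\Sigma+\Sigma M^\top+C=0$. The fiber of $M_0\in\mathrm{Stab}(E)$ is $\mathcal{F}_{G,C}(M_0)=\{M\in\mathrm{Stab}(E):\phi_{G,C}(M)=\phi_{G,C}(M_0)\}$. The model $\mathcal{M}_{G,C}$ is globally identifiable if $\mathcal{F}_{G,C}(M_0)=\{M_0\}$ for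 all $M_0\in\mathrm{Stab}(E)$. *)

theory Defs
  imports "HOL-Analysis.Analysis"
begin

(* The vertex set [p] is the finite index type 'n, with p = CARD('n); a directed graph on it
   is its edge relation E, where (i, j) \<in> E means i \<rightarrow> j. *)

definition all_self_loops :: "'n rel \<Rightarrow> bool" where
  "all_self_loops E \<longleftrightarrow> (\<forall>i. (i, i) \<in> E)"

definition simple_digraph :: "'n rel \<Rightarrow> bool" where
  "simple_digraph E \<longleftrightarrow> \<not> (\<exists>i j. i \<noteq> j \<and> (i, j) \<in> E \<and> (j, i) \<in> E)"

definition PD :: "(real ^ 'n ^ 'n) set" where
  "PD = {A. transpose A = A \<and> (\<forall>x. x \<noteq> 0 \<longrightarrow> x \<bullet> (A *v x) > 0)}"

definition diagonal_matrix :: "real ^ 'n ^ 'n \<Rightarrow> bool" where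
  "diagonal_matrix A \<longleftrightarrow> (\<forall>i j. i \<noteq> j \<longrightarrow> A $ i $ j = 0)"

definition eigenvalue :: "complex ^ 'n ^ 'n \<Rightarrow> complex \<Rightarrow> bool" where
  "eigenvalue A z \<longleftrightarrow> (\<exists>v. v \<noteq> 0 \<and> A *v v = z *s v)"

(* Eigenvalues of a real matrix are its complex eigenvalues. *)
definition stable_matrix :: "real ^ 'n ^ 'n \<Rightarrow> bool" where
  "stable_matrix M \<longleftrightarrow>
     (\<forall>z. eigenvalue (map_matrix complex_of_real M) z \<longrightarrow> Re z < 0)"

(* Note the transposed indices: the edge i \<rightarrow> j carries the entry in row j, column i. *)
definition edge_matrices :: "'n rel \<Rightarrow> (real ^ 'n ^ 'n) set" where
  "edge_matrices E = {M. \<forall>i j. (i, j) \<notin> E \<longrightarrow> M $ j $ i = 0}"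

definition Stab :: "'n rel \<Rightarrow> (real ^ 'n ^ 'n) set" where
  "Stab E = {M \<in> edge_matrices E. stable_matrix M}"

definition lyapunov_model :: "'n rel \<Rightarrow> real ^ 'n ^ 'n \<Rightarrow> (real ^ 'n ^ 'n) set" where
  "lyapunov_model E C =
     {S \<in> PD. \<exists>M \<in> edge_matrices E. M ** S + S ** transpose M = - C}"

(* For stable M the Lyapunov equation has exactly one solution, and it lies in PD when C does.
   The description is used only at stable M. *)
definition lyapunov_solution :: "real ^ 'n ^ 'n \<Rightarrow> real ^ 'n ^ 'n \<Rightarrow> real ^ 'n ^ 'n" where
  "lyapunov_solution C M = (THE S. M ** S + S ** transpose M + C = 0)"

definition fiber :: "'n rel \<Rightarrow> real ^ 'n ^ 'n \<Rightarrow> real ^ 'n ^ 'n \<Rightarrow> (real ^ 'n ^ 'n) set" where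
  "fiber E C M0 = {M \<in> Stab E. lyapunov_solution C M = lyapunov_solution C M0}"

(* Identifiability of lyapunov_model E C concerns its parametrization by Stab E, not the bare
   set of covariance matrices, so the predicate takes E and C. *)
definition globally_identifiable :: "'n rel \<Rightarrow> real ^ 'n ^ 'n \<Rightarrow> bool" where
  "globally_identifiable E C \<longleftrightarrow> (\<forall>M0 \<in> Stab E. fiber E C M0 = {M0})"

end

theory Submission
  imports Defs "HOL-Computational_Algebra.Fundamental_Theorem_Algebra"
begin

text \<open>If \<open>M\<close> and \<open>M\<^sub>0\<close> lie in one fiber, with common covariance \<open>S\<close>, then \<open>N = M - M\<^sub>0\<close> satisfies
  \<open>N S + S N\<^sup>T = 0\<close>, so \<open>N\<close> is skew-adjoint for the inner product given by \<open>S\<^sup>-\<^sup>1\<close>. Hence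
  \<open>tr (N\<^sup>2) \<le> 0\<close>, with equality only for \<open>N = 0\<close>. On a simple graph, \<open>n\<^sub>i\<^sub>j n\<^sub>j\<^sub>i = 0\<close> for
  \<open>i \<noteq> j\<close>, so \<open>tr (N\<^sup>2)\<close> is the sum of the squares of the diagonal entries, and \<open>N = 0\<close>.

  Conversely, for diagonal \<open>C\<close> a 2-cycle \<open>i \<rightarrow> j \<rightarrow> i\<close> gives the stable matrices \<open>- C / 2\<close> and
  \<open>- C / 2 + (e\<^sub>i e\<^sub>j\<^sup>T - e\<^sub>j e\<^sub>i\<^sup>T)\<close>, both with covariance \<open>I\<close>.

  That the Lyapunov equation with stable \<open>M\<close> has exactly one solution, and that it is positive
  definite, follows by iterating its Cayley transform. The required decay of matrix powers needs no
  normal form: a polynomial annihilating a vector is split into linear factors, and these are removed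
  one at a time.\<close>

section \<open>Decay of matrix powers\<close>

lemma matrix_vector_funpow_add:
  fixes A :: "'a::comm_ring_1 ^ 'n ^ 'n"
  shows "(((*v) A) ^^ k) (x + y) = (((*v) A) ^^ k) x + (((*v) A) ^^ k) y"
  by (induction k) (simp_all add: matrix_vector_right_distrib)

lemma matrix_vector_funpow_scale:
  fixes A :: "'a::field ^ 'n ^ 'n"
  shows "(((*v) A) ^^ k) (c *s x) = c *s (((*v) A) ^^ k) x"
  by (induction k) (simp_all add: vector_scalar_commute)

text \<open>This is p(A) x, written through the iterates of x under A so that no matrix polynomial
  has to be formed.\<close>

definition poly_act :: "'a::field ^ 'n ^ 'n \<Rightarrow> 'a poly \<Rightarrow> 'a ^ 'n \<Rightarrow> 'a ^ 'n" where
  "poly_act A p x = (\<Sum>i\<le>degree p. coeff p i *s (((*v) A) ^^ i) x)"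

lemma poly_act_altdef:
  assumes "degree p \<le> n"
  shows "poly_act A p x = (\<Sum>i\<le>n. coeff p i *s (((*v) A) ^^ i) x)"
  unfolding poly_act_def
  by (rule sum.mono_neutral_left) (use assms in \<open>auto simp: not_le coeff_eq_0\<close>)

lemma poly_act_pCons: "poly_act A (pCons a p) x = a *s x + poly_act A p (A *v x)"
proof -
  have "poly_act A (pCons a p) x = (\<Sum>i\<le>Suc (degree p). coeff (pCons a p) i *s (((*v) A) ^^ i) x)"
    by (rule poly_act_altdef) (rule degree_pCons_le)
  also have "\<dots> = a *s x + (\<Sum>i\<le>degree p. coeff p i *s (((*v) A) ^^ Suc i) x)"
    by (subst sum.atMost_Suc_shift) simp
  also have "\<dots> = a *s x + poly_act A p (A *v x)"
    unfolding poly_act_def by (simp add: funpow_swap1)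
  finally show ?thesis .
qed

lemma poly_act_smult: "poly_act A (smult c p) x = poly_act A p (c *s x)"
proof -
  have "poly_act A (smult c p) x = (\<Sum>i\<le>degree p. coeff (smult c p) i *s (((*v) A) ^^ i) x)"
    by (rule poly_act_altdef) (rule degree_smult_le)
  then show ?thesis
    by (simp add: poly_act_def matrix_vector_funpow_scale mult_ac)
qed

lemma poly_act_add_poly: "poly_act A (p + q) x = poly_act A p x + poly_act A q x"
  by (simp add: poly_act_altdef[of _ "max (degree p) (degree q)"] degree_add_le
      sum.distrib vector_sadd_rdistrib)

lemma poly_act_add_vec: "poly_act A p (x + y) = poly_act A p x + poly_act A p y"
  by (simp add: poly_act_def matrix_vector_funpow_add vector_add_ldistrib sum.distrib)

text \<open>Moves a linear factor from the polynomial onto the vector, which lowers the degree in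
  the induction on annihilating polynomials.\<close>

lemma poly_act_linear_factor:
  "poly_act A ([:- c, 1:] * q) x = poly_act A q (A *v x - c *s x)"
proof -
  have "[:- c, 1:] * q = smult (- c) q + pCons 0 q"
    by simp
  then have "poly_act A ([:- c, 1:] * q) x = poly_act A q ((- c) *s x) + poly_act A q (A *v x)"
    by (simp only: poly_act_add_poly poly_act_pCons poly_act_smult) simp
  also have "\<dots> = poly_act A q ((- c) *s x + A *v x)"
    by (simp only: poly_act_add_vec)
  also have "(- c) *s x + A *v x = A *v x - c *s x"
    by (simp add: vec_eq_iff)
  finally show ?thesis .
qed

text \<open>The first \<open>CARD('n) + 1\<close> iterates of x are too many to be independent, and
  a linear relation among them is a polynomial.\<close>

lemma annihilating_poly_exists:
  fixes A :: "'a::field ^ 'n ^ 'n"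
  obtains p where "p \<noteq> 0" "poly_act A p x = 0"
proof -
  let ?f = "\<lambda>i. (((*v) A) ^^ i) x"
  have "\<exists>p. p \<noteq> 0 \<and> poly_act A p x = 0"
  \<comment> \<open>Dependence is a property of sets, in which equal iterates collapse. If two
    iterates coincide, the difference of the two monomials serves instead.\<close>
  proof (cases "inj_on ?f {..CARD('n)}")
    case True
    let ?S = "?f ` {..CARD('n)}"
    have "card ?S = CARD('n) + 1"
      using True by (simp add: card_image)
    moreover have "vec.dim ?S \<le> CARD('n)"
      using vec.dim_subset_UNIV[of ?S] by (simp add: card_cart_basis vec.dimension_def)
    ultimately have "vec.dependent ?S"
      by (intro vec.dependent_biggerset_general) simp
    then obtain u where u: "(\<Sum>v\<in>?S. u v *s v) = 0" and "\<exists>v\<in>?S. u v \<noteq> 0"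
      by (auto simp: vec.dependent_finite)
    then obtain i where i: "i \<le> CARD('n)" "u (?f i) \<noteq> 0"
      by auto
    define p where "p = (\<Sum>j\<le>CARD('n). monom (u (?f j)) j)"
    have coeff: "coeff p j = (if j \<le> CARD('n) then u (?f j) else 0)" for j
      by (simp add: p_def coeff_sum if_distrib sum.delta cong: if_cong)
    have "p \<noteq> 0"
      using i coeff[of i] by auto
    moreover have "degree p \<le> CARD('n)"
      by (rule degree_le) (simp add: coeff)
    then have "poly_act A p x = (\<Sum>j\<le>CARD('n). u (?f j) *s ?f j)"
      by (simp add: poly_act_altdef coeff)
    then have "poly_act A p x = 0"
      using u by (simp add: sum.reindex[OF True])
    ultimately show ?thesis by blast
  next
    case False
    then obtain i j where ij: "i \<noteq> j" "?f i = ?f j"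
      by (auto simp: inj_on_def)
    define p where "p = monom (1::'a) i + monom (- 1) j"
    have "coeff p i = 1" using ij by (simp add: p_def)
    then have "p \<noteq> 0" by auto
    moreover have act: "poly_act A (monom c k) x = c *s ?f k" for c k
    proof -
      have "poly_act A (monom c k) x = (\<Sum>l\<le>k. coeff (monom c k) l *s ?f l)"
        by (rule poly_act_altdef) (rule degree_monom_le)
      also have "\<dots> = (\<Sum>l\<le>k. if l = k then c *s ?f k else 0)"
        by (rule sum.cong) auto
      finally show ?thesis by simp
    qed
    have "poly_act A p x = 0"
      using ij unfolding p_def poly_act_add_poly act by simp
    ultimately show ?thesis by blast
  qed
  then show ?thesis using that by blast
qed

text \<open>Summing the recurrence bounds a partial sum by r times itself plus a constant; since r <
  1, this can be solved for the partial sum.\<close>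

lemma summable_recurrence:
  fixes a e :: "nat \<Rightarrow> real"
  assumes nonneg: "\<And>k. 0 \<le> a k" and r: "0 \<le> r" "r < 1" and e: "summable e" "\<And>k. 0 \<le> e k"
    and step: "\<And>k. a (Suc k) \<le> r * a k + e k"
  shows "summable a"
proof (rule bounded_imp_summable)
  have le: "(\<Sum>k\<le>n. a k) \<le> a 0 + r * (\<Sum>k\<le>n. a k) + suminf e" for n
  proof -
    have "(\<Sum>k\<le>n. a k) \<le> (\<Sum>k\<le>Suc n. a k)" using nonneg by simp
    also have "\<dots> = a 0 + (\<Sum>k\<le>n. a (Suc k))" by (rule sum.atMost_Suc_shift)
    also have "\<dots> \<le> a 0 + (\<Sum>k\<le>n. r * a k + e k)"
      by (intro add_left_mono sum_mono step)
    also have "\<dots> = a 0 + r * (\<Sum>k\<le>n. a k) + (\<Sum>k\<le>n. e k)"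
      by (simp add: sum.distrib sum_distrib_left)
    also have "(\<Sum>k\<le>n. e k) \<le> suminf e"
      using e by (intro sum_le_suminf) auto
    finally show ?thesis by simp
  qed
  show "(\<Sum>k\<le>n. a k) \<le> (a 0 + suminf e) / (1 - r)" for n
    using le[of n] r by (simp add: field_simps)
qed (rule nonneg)

section \<open>Eigenvalues, invertibility and complexification\<close>

lemma mat_mult_vector: "mat c *v x = c *s (x :: 'a::semiring_1 ^ 'n)"
proof -
  have "(mat c *v x) $ i = c * x $ i" for i
  proof -
    have "(mat c *v x) $ i = (\<Sum>j\<in>UNIV. (if i = j then c else 0) * x $ j)"
      by (simp add: matrix_vector_mult_def mat_def)
    also have "\<dots> = (\<Sum>j\<in>UNIV. if j = i then c * x $ i else 0)"
      by (rule sum.cong) auto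
    finally show ?thesis by simp
  qed
  then show ?thesis
    by (simp add: vec_eq_iff)
qed

lemma eigenvalue_iff_not_invertible: "eigenvalue A z \<longleftrightarrow> \<not> invertible (A - mat z)"
proof -
  have "invertible (A - mat z) \<longleftrightarrow> (\<forall>x. (A - mat z) *v x = 0 \<longrightarrow> x = 0)"
    by (simp add: invertible_left_inverse matrix_left_invertible_ker)
  then show ?thesis
    by (auto simp: eigenvalue_def matrix_vector_mult_diff_rdistrib mat_mult_vector)
qed

lemma eigenvalue_transpose: "eigenvalue (transpose A) z \<longleftrightarrow> eigenvalue A z"
proof -
  have "transpose (A - mat z) = transpose A - mat z"
    by (simp add: vec_eq_iff transpose_def mat_def)
  then show ?thesis
    unfolding eigenvalue_iff_not_invertible
    by (metis invertible_left_inverse invertible_right_inverse left_invertible_transpose)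
qed

definition complex_vec :: "real ^ 'n \<Rightarrow> complex ^ 'n" where
  "complex_vec v = (\<chi> j. complex_of_real (v $ j))"

lemma complex_vec_mult: "map_matrix complex_of_real A *v complex_vec v = complex_vec (A *v v)"
  by (simp add: complex_vec_def vec_eq_iff matrix_vector_mult_def)

lemma complex_vec_eq_0_iff: "complex_vec v = 0 \<longleftrightarrow> v = 0"
  by (simp add: complex_vec_def vec_eq_iff)

lemma norm_vector_scalar_mult: "norm (c *s x) = norm c * norm (x :: complex ^ 'n)"
  by (simp add: norm_vec_def norm_mult L2_set_right_distrib)

text \<open>Induction on the degree: for a root z of p, the vector (A - z) x is annihilated by the
  cofactor q, so its orbit is summable, and this is carried back to x. The claim is summability
  rather than convergence to 0 because it passes through \<open>summable_recurrence\<close>.\<close>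

lemma summable_norm_powers_poly:
  fixes A :: "complex ^ 'n ^ 'n"
  assumes ev: "\<And>z. eigenvalue A z \<Longrightarrow> norm z < 1"
    and "p \<noteq> 0" "poly_act A p x = 0"
  shows "summable (\<lambda>k. norm ((((*v) A) ^^ k) x))"
  using assms(2,3)
proof (induction "degree p" arbitrary: p x rule: less_induct)
  case less
  show ?case
  proof (cases "degree p = 0")
    case True
    then obtain c where p: "p = [:c:]"
      by (rule degree_eq_zeroE)
    then have "c \<noteq> 0" "c *s x = 0"
      using less.prems by (simp_all add: poly_act_def)
    then have "x = 0"
      by (simp add: vec_eq_iff)
    have "(((*v) A) ^^ k) 0 = 0" for k
      by (induction k) simp_all
    then show ?thesis
      using \<open>x = 0\<close> by simp
  next
    case False
    then have "\<not> constant (poly p)"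
      by (simp add: constant_degree)
    then obtain z where "poly p z = 0"
      using fundamental_theorem_of_algebra by blast
    then have "[:- z, 1:] dvd p"
      by (simp only: poly_eq_0_iff_dvd)
    then obtain q where p: "p = [:- z, 1:] * q" ..
    let ?y = "A *v x - z *s x"
    have "q \<noteq> 0" using p less.prems by auto
    then have "degree p = degree q + 1"
      unfolding p by (subst degree_mult_eq) auto
    moreover have "poly_act A q ?y = 0"
      using less.prems unfolding p by (simp only: poly_act_linear_factor)
    ultimately have y: "summable (\<lambda>k. norm ((((*v) A) ^^ k) ?y))"
      using \<open>q \<noteq> 0\<close> by (intro less.hyps) simp_all
    \<comment> \<open>A commutes with its own powers, so the orbit of \<open>?y\<close> is the image
      under A - z of the orbit of x.\<close>
    have comm: "(((*v) A) ^^ k) ?y = A *v ((((*v) A) ^^ k) x) - z *s ((((*v) A) ^^ k) x)" for k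
    proof -
      have "(((*v) A) ^^ k) ?y = (((*v) A) ^^ k) (A *v x + (- z) *s x)"
        by (simp add: vec_eq_iff)
      also have "\<dots> = A *v ((((*v) A) ^^ k) x) + (- z) *s ((((*v) A) ^^ k) x)"
        unfolding matrix_vector_funpow_add matrix_vector_funpow_scale by (simp add: funpow_swap1)
      finally show ?thesis by simp
    qed
    show ?thesis
    \<comment> \<open>The polynomial need not be minimal, so its root z may fail to be an
      eigenvalue. If it is one, |z| < 1 and the orbit of x satisfies a contracting recurrence; if
      not, A - z has a bounded inverse B that maps the orbit of \<open>?y\<close> to that of
      x.\<close>
    proof (cases "eigenvalue A z")
      case True
      show ?thesis
      proof (rule summable_recurrence[OF _ _ _ y])
        show "norm z < 1" using ev True .
        fix k
        have "(((*v) A) ^^ Suc k) x = z *s ((((*v) A) ^^ k) x) + (((*v) A) ^^ k) ?y"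
          unfolding comm by simp
        then show "norm ((((*v) A) ^^ Suc k) x)
            \<le> norm z * norm ((((*v) A) ^^ k) x) + norm ((((*v) A) ^^ k) ?y)"
          by (simp only: norm_vector_scalar_mult[symmetric] norm_triangle_ineq)
      qed auto
    next
      case False
      then obtain B where "B ** (A - mat z) = mat 1"
        by (auto simp: eigenvalue_iff_not_invertible invertible_left_inverse)
      have B: "B *v (A *v v - z *s v) = v" for v
      proof -
        have "B *v (A *v v - z *s v) = (B ** (A - mat z)) *v v"
          by (simp only: matrix_vector_mul_assoc[symmetric] matrix_vector_mult_diff_rdistrib
              mat_mult_vector)
        then show ?thesis
          using \<open>B ** (A - mat z) = mat 1\<close> by simp
      qed
      obtain K where K: "\<And>v. norm (B *v v) \<le> norm v * K"
        using bounded_linear.bounded[OF matrix_vector_mul_bounded_linear[of B]] by blast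
      have "norm ((((*v) A) ^^ k) x) \<le> norm ((((*v) A) ^^ k) ?y) * K" for k
        using K[of "(((*v) A) ^^ k) ?y"] unfolding comm B .
      then show ?thesis
        by (intro summable_comparison_test'[OF summable_mult2[OF y, of K], of 0]) simp
    qed
  qed
qed

lemma powers_tendsto_0:
  fixes A :: "complex ^ 'n ^ 'n"
  assumes "\<And>z. eigenvalue A z \<Longrightarrow> norm z < 1"
  shows "(\<lambda>k. (((*v) A) ^^ k) x) \<longlonglongrightarrow> 0"
proof -
  obtain p where "p \<noteq> 0" "poly_act A p x = 0"
    by (rule annihilating_poly_exists)
  from summable_norm_powers_poly[of A, OF assms this]
  have "summable (\<lambda>k. norm ((((*v) A) ^^ k) x))" .
  then show ?thesis
    by (rule tendsto_norm_zero_cancel[OF summable_LIMSEQ_zero])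
qed

lemma real_powers_tendsto_0:
  fixes A :: "real ^ 'n ^ 'n"
  assumes "\<And>z. eigenvalue (map_matrix complex_of_real A) z \<Longrightarrow> norm z < 1"
  shows "(\<lambda>k. (((*v) A) ^^ k) x) \<longlonglongrightarrow> 0"
proof (rule vec_tendstoI)
  fix i
  have "(((*v) (map_matrix complex_of_real A)) ^^ k) (complex_vec x) = complex_vec ((((*v) A) ^^ k) x)" for k
    by (induction k) (simp_all add: complex_vec_mult)
  moreover have "(\<lambda>k. (((*v) (map_matrix complex_of_real A)) ^^ k) (complex_vec x)) \<longlonglongrightarrow> 0"
    by (rule powers_tendsto_0) (rule assms)
  ultimately have "(\<lambda>k. complex_vec ((((*v) A) ^^ k) x)) \<longlonglongrightarrow> 0"
    by simp
  from tendsto_vec_nth[OF this, of i]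
  have "(\<lambda>k. complex_of_real ((((*v) A) ^^ k) x $ i)) \<longlonglongrightarrow> complex_of_real 0"
    by (simp add: complex_vec_def)
  then show "(\<lambda>k. (((*v) A) ^^ k) x $ i) \<longlonglongrightarrow> 0 $ i"
    by (simp only: tendsto_of_real_iff zero_index)
qed

section \<open>The Lyapunov equation\<close>

lemma stable_transpose: "stable_matrix (transpose M) \<longleftrightarrow> stable_matrix M"
proof -
  have "map_matrix complex_of_real (transpose M) = transpose (map_matrix complex_of_real M)"
    by (simp add: vec_eq_iff transpose_def)
  then show ?thesis
    by (simp add: stable_matrix_def eigenvalue_transpose)
qed

text \<open>A nonzero fixed vector would make 1 an eigenvalue, but its real part is positive. Hence
  1 - M is invertible and the Cayley transform makes sense.\<close>

lemma stable_no_fixed_vector: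
  assumes "stable_matrix M" "M *v x = x"
  shows "x = 0"
proof (rule ccontr)
  assume "x \<noteq> 0"
  then have "eigenvalue (map_matrix complex_of_real M) 1"
    unfolding eigenvalue_def
    by (intro exI[of _ "complex_vec x"]) (simp add: complex_vec_mult assms(2) complex_vec_eq_0_iff)
  then show False
    using assms(1) by (auto simp: stable_matrix_def)
qed

section \<open>The Cayley transform: from the left half-plane to the unit disc\<close>

lemma norm_less_1_iff_Re_Cayley:
  assumes "z \<noteq> - 1"
  shows "norm z < 1 \<longleftrightarrow> Re ((z - 1) / (1 + z)) < 0"
proof -
  have pos: "(Re (1 + z))\<^sup>2 + (Im (1 + z))\<^sup>2 > 0"
    using assms by (auto simp: complex_eq_iff sum_power2_gt_zero_iff add_eq_0_iff)
  \<comment> \<open>The numerator is the real part of (z - 1) times the conjugate of 1 + z.\<close>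
  have "Re ((z - 1) / (1 + z)) = ((norm z)\<^sup>2 - 1) / ((Re (1 + z))\<^sup>2 + (Im (1 + z))\<^sup>2)"
    unfolding Re_divide cmod_power2 by (simp add: algebra_simps power2_eq_square)
  then have "Re ((z - 1) / (1 + z)) < 0 \<longleftrightarrow> (norm z)\<^sup>2 < 1\<^sup>2"
    using pos by (simp add: divide_less_0_iff)
  then show ?thesis
    by (simp add: abs_square_less_1)
qed

lemma map_matrix_of_real_mult:
  "map_matrix complex_of_real (A ** B) = map_matrix complex_of_real A ** map_matrix complex_of_real B"
  by (simp add: vec_eq_iff matrix_matrix_mult_def)

text \<open>If v is an eigenvector of (1 + M) B for z, then u = B v satisfies (1 + z) M u = (z - 1)
  u, so (z - 1) / (1 + z) is an eigenvalue of M and has negative real part.\<close>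

lemma stable_Cayley_eigenvalue:
  fixes M B :: "real ^ 'n ^ 'n"
  assumes "stable_matrix M" and B: "(mat 1 - M) ** B = mat 1"
    and "eigenvalue (map_matrix complex_of_real ((mat 1 + M) ** B)) z"
  shows "norm z < 1"
proof -
  let ?c = "map_matrix complex_of_real"
  have map: "?c (mat 1 + M) = mat 1 + ?c M" "?c (mat 1 - M) = mat 1 - ?c M" "?c (mat 1) = mat 1"
    by (simp_all add: vec_eq_iff mat_def)
  obtain v where v: "v \<noteq> 0" "?c ((mat 1 + M) ** B) *v v = z *s v"
    using assms(3) by (auto simp: eigenvalue_def)
  define u where "u = ?c B *v v"
  have "(mat 1 - ?c M) *v u = v"
    unfolding u_def matrix_vector_mul_assoc map(2)[symmetric] map_matrix_of_real_mult[symmetric] B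
    by (simp add: map(3))
  then have vu: "v = u - ?c M *v u"
    by (simp add: matrix_vector_mult_diff_rdistrib)
  then have "u \<noteq> 0" using v by auto
  have "(mat 1 + ?c M) *v u = z *s v"
    using v(2)
    unfolding u_def matrix_vector_mul_assoc map(1)[symmetric] map_matrix_of_real_mult[symmetric] .
  then have "u + ?c M *v u = z *s (u - ?c M *v u)"
    unfolding vu by (simp add: matrix_vector_mult_add_rdistrib)
  then have eq: "(1 + z) * (?c M *v u) $ i = (z - 1) * u $ i" for i
    by (simp add: vec_eq_iff algebra_simps)
  \<comment> \<open>For z = -1 the equation would read 0 = -2 u.\<close>
  have z: "z \<noteq> - 1"
    using eq \<open>u \<noteq> 0\<close> by (auto simp: vec_eq_iff)
  then have "1 + z \<noteq> 0" by (simp add: add_eq_0_iff)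
  then have "?c M *v u = ((z - 1) / (1 + z)) *s u"
    using eq by (simp add: vec_eq_iff field_simps)
  then have "Re ((z - 1) / (1 + z)) < 0"
    using assms(1) \<open>u \<noteq> 0\<close> by (auto simp: stable_matrix_def eigenvalue_def)
  then show ?thesis
    using norm_less_1_iff_Re_Cayley[OF z] by simp
qed

lemma inner_transpose_mult: "(transpose M *v x) \<bullet> y = x \<bullet> (M *v y)" for M :: "real ^ 'n ^ 'm"
  by (simp add: dot_lmul_matrix)

definition Cayley_transform :: "real ^ 'n ^ 'n \<Rightarrow> real ^ 'n ^ 'n" where
  "Cayley_transform M = (mat 1 + M) ** matrix_inv (mat 1 - M)"

lemma stable_one_minus_inverse:
  assumes "stable_matrix M"
  shows "(mat 1 - M) ** matrix_inv (mat 1 - M) = mat 1"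
proof -
  have "\<forall>x. (mat 1 - M) *v x = 0 \<longrightarrow> x = 0"
  proof (intro allI impI)
    fix x assume "(mat 1 - M) *v x = 0"
    then have "M *v x = x"
      unfolding matrix_vector_mult_diff_rdistrib by simp
    then show "x = 0" by (rule stable_no_fixed_vector[OF assms])
  qed
  then have "invertible (mat 1 - M)"
    by (simp add: invertible_left_inverse matrix_left_invertible_ker)
  then show ?thesis
    unfolding invertible_def matrix_inv_def by (rule someI2_ex) blast
qed

lemma Cayley_powers_tendsto_0:
  assumes "stable_matrix M"
  shows "(\<lambda>k. (((*v) (Cayley_transform M)) ^^ k) x) \<longlonglongrightarrow> 0"
  unfolding Cayley_transform_def
  by (rule real_powers_tendsto_0)
    (rule stable_Cayley_eigenvalue[OF assms stable_one_minus_inverse[OF assms]])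

text \<open>The Cayley transform turns the Lyapunov equation into the discrete-time (Stein) equation
  \<open>S = T\<^sup>T S T + 2 B\<^sup>T C B\<close>, which can be iterated because the powers of \<open>T\<close> tend to 0.\<close>

lemma Lyapunov_imp_Stein:
  fixes M :: "real ^ 'n ^ 'n"
  assumes M: "stable_matrix M" and eq: "M ** S + S ** transpose M + C = 0"
  defines "T \<equiv> Cayley_transform (transpose M)" and "B \<equiv> matrix_inv (mat 1 - transpose M)"
  shows "x \<bullet> (S *v y) = (T *v x) \<bullet> (S *v (T *v y)) + 2 * ((B *v x) \<bullet> (C *v (B *v y)))"
proof -
  let ?N = "transpose M"
  have B: "(mat 1 - ?N) ** B = mat 1"
    unfolding B_def using M by (intro stable_one_minus_inverse) (simp add: stable_transpose)
  define w where "w = B *v x"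
  define w' where "w' = B *v y"
  \<comment> \<open>In terms of w = B x, both x and T x are explicit and differ only in a sign;
    likewise for y.\<close>
  have x: "x = w - ?N *v w" "y = w' - ?N *v w'"
    using arg_cong[OF B, of "\<lambda>A. A *v x"] arg_cong[OF B, of "\<lambda>A. A *v y"]
    unfolding w_def w'_def matrix_vector_mul_assoc[symmetric] matrix_vector_mult_diff_rdistrib
    by simp_all
  have Tx: "T *v x = w + ?N *v w" "T *v y = w' + ?N *v w'"
    unfolding T_def Cayley_transform_def B_def[symmetric] w_def w'_def
      matrix_vector_mul_assoc[symmetric] matrix_vector_mult_add_rdistrib by simp_all
  have "w \<bullet> ((M ** S + S ** ?N + C) *v w') = 0"
    using eq by simp
  then have C: "w \<bullet> (C *v w') = - ((?N *v w) \<bullet> (S *v w')) - w \<bullet> (S *v (?N *v w'))"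
    unfolding matrix_vector_mult_add_rdistrib matrix_vector_mul_assoc[symmetric]
      inner_add_right inner_transpose_mult by linarith
  show ?thesis
    \<comment> \<open>The two forms differ only in the sign of the cross terms, whose sum is the
      negative of the C-term.\<close>
    unfolding Tx w_def[symmetric] w'_def[symmetric] C unfolding x
    by (simp add: inner_add_left inner_add_right inner_diff_left inner_diff_right
        matrix_vector_right_distrib matrix_vector_mult_diff_distrib del: transpose_matrix_vector)
qed

lemma tendsto_form_0:
  fixes S :: "real ^ 'n ^ 'n"
  assumes "(f \<longlongrightarrow> 0) F" "(g \<longlongrightarrow> 0) F"
  shows "((\<lambda>k. f k \<bullet> (S *v g k)) \<longlongrightarrow> 0) F"
proof -
  have "((\<lambda>k. S *v g k) \<longlongrightarrow> S *v 0) F"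
    by (rule bounded_linear.tendsto[OF matrix_vector_mul_bounded_linear assms(2)])
  from tendsto_inner[OF assms(1) this] show ?thesis by simp
qed

text \<open>For C = 0 the bilinear form of S is invariant under T, while its values along orbits of
  T tend to 0.\<close>

lemma Lyapunov_homogeneous:
  fixes M S :: "real ^ 'n ^ 'n"
  assumes "stable_matrix M" "M ** S + S ** transpose M = 0"
  shows "S = 0"
proof -
  define T where "T = Cayley_transform (transpose M)"
  have lim: "(\<lambda>k. (((*v) T) ^^ k) x) \<longlonglongrightarrow> 0" for x
    unfolding T_def using assms(1) by (intro Cayley_powers_tendsto_0) (simp add: stable_transpose)
  have step: "x \<bullet> (S *v y) = (T *v x) \<bullet> (S *v (T *v y))" for x y
    using Lyapunov_imp_Stein[of M S 0 x y] assms by (simp add: T_def)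
  have "x \<bullet> (S *v y) = ((((*v) T) ^^ k) x) \<bullet> (S *v ((((*v) T) ^^ k) y))" for x y k
  proof (induction k)
    case (Suc k)
    then show ?case
      unfolding funpow.simps(2) comp_def step[of "(((*v) T) ^^ k) x", symmetric] .
  qed simp
  moreover have "(\<lambda>k. ((((*v) T) ^^ k) x) \<bullet> (S *v ((((*v) T) ^^ k) y))) \<longlonglongrightarrow> 0" for x y
    by (rule tendsto_form_0[OF lim lim])
  ultimately have "x \<bullet> (S *v y) = 0" for x y
    by (simp add: LIMSEQ_const_iff)
  then have "S *v y = 0 *v y" for y
    using inner_eq_zero_iff[of "S *v y"] by simp
  then show ?thesis
    unfolding matrix_eq by blast
qed

section \<open>Unique solvability and positive definiteness\<close>

lemma Lyapunov_unique:
  fixes M :: "real ^ 'n ^ 'n"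
  assumes "stable_matrix M" "M ** S + S ** transpose M + C = 0" "M ** S' + S' ** transpose M + C = 0"
  shows "S = S'"
proof -
  have "M ** (S - S') + (S - S') ** transpose M
      = (M ** S + S ** transpose M + C) - (M ** S' + S' ** transpose M + C)"
    by (simp add: vec_eq_iff matrix_matrix_mult_def sum_subtractf algebra_simps)
  then have "S - S' = 0"
    unfolding assms(2,3) diff_self by (rule Lyapunov_homogeneous[OF assms(1)])
  then show ?thesis by simp
qed

text \<open>The Lyapunov operator is an injective linear map of a finite-dimensional space into
  itself, hence surjective.\<close>

lemma Lyapunov_exists:
  fixes M :: "real ^ 'n ^ 'n"
  assumes "stable_matrix M"
  shows "\<exists>S. M ** S + S ** transpose M + C = 0"
proof -
  let ?L = "\<lambda>S. M ** S + S ** transpose M"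
  have lin: "linear ?L"
    by (rule linearI)
      (simp_all add: vec_eq_iff matrix_matrix_mult_def sum.distrib sum_distrib_left algebra_simps)
  moreover have "inj ?L"
    unfolding linear_injective_0[OF lin] using Lyapunov_homogeneous[OF assms] by blast
  ultimately have "surj ?L"
    by (rule linear_injective_imp_surjective) (rule refl)
  then obtain S where "- C = ?L S"
    by (rule surjE)
  then show ?thesis
    by (intro exI[of _ S]) (simp flip: \<open>- C = ?L S\<close>)
qed

lemma lyapunov_solution_eq:
  fixes M :: "real ^ 'n ^ 'n"
  assumes "stable_matrix M" "M ** S + S ** transpose M + C = 0"
  shows "lyapunov_solution C M = S"
  unfolding lyapunov_solution_def using assms by (blast intro: Lyapunov_unique)

lemma lyapunov_solution:
  fixes M :: "real ^ 'n ^ 'n"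
  assumes "stable_matrix M"
  shows "M ** lyapunov_solution C M + lyapunov_solution C M ** transpose M + C = 0"
  using Lyapunov_exists[OF assms] lyapunov_solution_eq[OF assms] by metis

text \<open>Symmetry follows from uniqueness, as the transpose solves the same equation. By the
  Stein equation the quadratic form of S does not increase along orbits of T and tends to 0 there,
  so it is nonnegative; the C-term then makes it strictly positive because B is injective.\<close>

lemma lyapunov_solution_PD:
  fixes M :: "real ^ 'n ^ 'n"
  assumes M: "stable_matrix M" and C: "C \<in> PD"
  shows "lyapunov_solution C M \<in> PD"
proof -
  define S where "S = lyapunov_solution C M"
  have S: "M ** S + S ** transpose M + C = 0"
    unfolding S_def by (rule lyapunov_solution[OF M])
  have tr_add: "transpose (X + Y) = transpose X + transpose Y" for X Y :: "real ^ 'n ^ 'n"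
    by (simp add: transpose_def vec_eq_iff)
  have "transpose (M ** S + S ** transpose M + C) = transpose 0"
    by (simp only: S)
  moreover have "transpose C = C" "transpose (0 :: real ^ 'n ^ 'n) = 0"
    using C by (simp_all add: PD_def transpose_def vec_eq_iff)
  ultimately have "M ** transpose S + transpose S ** transpose M + C = 0"
    by (simp add: tr_add matrix_transpose_mul add.commute)
  then have sym: "transpose S = S"
    using S by (rule Lyapunov_unique[OF M])
  define T where "T = Cayley_transform (transpose M)"
  define B where "B = matrix_inv (mat 1 - transpose M)"
  have N: "stable_matrix (transpose M)"
    using M by (simp add: stable_transpose)
  have lim: "(\<lambda>k. (((*v) T) ^^ k) x) \<longlonglongrightarrow> 0" for x
    unfolding T_def by (rule Cayley_powers_tendsto_0[OF N])
  have B: "x = 0" if "B *v x = 0" for x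
    using arg_cong[OF stable_one_minus_inverse[OF N], of "\<lambda>A. A *v x"] that
    by (simp add: matrix_vector_mul_assoc[symmetric] B_def)
  note T = Lyapunov_imp_Stein[OF M S, folded T_def B_def]
  have C_pos: "0 < x \<bullet> (C *v x)" if "x \<noteq> 0" for x
    using C that by (simp add: PD_def)
  have C_nonneg: "0 \<le> x \<bullet> (C *v x)" for x
    using C_pos[of x] by (cases "x = 0") auto
  have step: "(T *v x) \<bullet> (S *v (T *v x)) \<le> x \<bullet> (S *v x)" for x
    using T[of x x] C_nonneg[of "B *v x"] by linarith
  have iter: "((((*v) T) ^^ k) x) \<bullet> (S *v ((((*v) T) ^^ k) x)) \<le> x \<bullet> (S *v x)" for x k
  proof (induction k)
    case (Suc k)
    then show ?case
      using step[of "(((*v) T) ^^ k) x"] by simp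
  qed simp
  have nonneg: "0 \<le> x \<bullet> (S *v x)" for x
    by (rule LIMSEQ_le_const2[OF tendsto_form_0[OF lim lim]]) (use iter in blast)
  have "0 < x \<bullet> (S *v x)" if "x \<noteq> 0" for x
  proof -
    have "0 < (B *v x) \<bullet> (C *v (B *v x))"
      using B that by (intro C_pos) auto
    then show ?thesis
      using T[of x x] nonneg[of "T *v x"] by linarith
  qed
  with sym show ?thesis
    by (simp add: PD_def S_def)
qed

section \<open>Matrices that are skew with respect to a positive definite form\<close>

lemma quadratic_form_add_axis:
  fixes A :: "real ^ 'n ^ 'n"
  assumes "transpose A = A"
  shows "(x + t *\<^sub>R axis k 1) \<bullet> (A *v (x + t *\<^sub>R axis k 1))
    = x \<bullet> (A *v x) + 2 * t * (A *v x) $ k + t\<^sup>2 * A $ k $ k"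
proof -
  have col: "(A *v axis k 1) $ i = A $ i $ k" for i
    by (simp add: matrix_vector_mult_basis column_def)
  have "x \<bullet> (A *v axis k 1) = (A *v x) $ k"
    by (metis assms dot_lmul_matrix inner_commute inner_axis transpose_matrix_vector inner_real_def mult.right_neutral)
  then show ?thesis
    by (simp add: matrix_vector_right_distrib matrix_vector_mult_scaleR inner_add_left inner_add_right
        inner_axis inner_axis' col power2_eq_square algebra_simps)
qed

text \<open>One step of the Cholesky elimination clears row and column \<open>k\<close>. If the pivot vanishes, then so
  does its row, and the junk value \<open>x / 0 = 0\<close> makes the step trivial.\<close>

lemma Cholesky_step:
  fixes A :: "real ^ 'n ^ 'n" and k :: 'n
  assumes sym: "transpose A = A" and psd: "\<And>x. 0 \<le> x \<bullet> (A *v x)"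
  defines "A' \<equiv> \<chi> i j. A $ i $ j - A $ k $ i * A $ k $ j / A $ k $ k"
  shows "0 \<le> A $ k $ k" "transpose A' = A'" "0 \<le> x \<bullet> (A' *v x)" "A' $ k $ j = 0"
proof -
  have quad: "0 \<le> x \<bullet> (A *v x) + 2 * t * (A *v x) $ k + t\<^sup>2 * A $ k $ k" for x t
    unfolding quadratic_form_add_axis[OF sym, symmetric] by (rule psd)
  show pivot: "0 \<le> A $ k $ k"
    using quad[of 0 1] by simp
  have sym': "A $ i $ j = A $ j $ i" for i j
    using arg_cong[OF sym, of "\<lambda>M. M $ j $ i"] by (simp add: transpose_def)
  show "transpose A' = A'"
    by (simp add: A'_def transpose_def vec_eq_iff sym' mult.commute)
  \<comment> \<open>With a vanishing pivot, \<open>quad\<close> is affine in t, so its slope must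
    vanish; the t below would give it the value -1.\<close>
  have zero: "(A *v x) $ k = 0" if "A $ k $ k = 0" for x
  proof (rule ccontr)
    assume nz: "(A *v x) $ k \<noteq> 0"
    define t where "t = - (x \<bullet> (A *v x) + 1) / (2 * (A *v x) $ k)"
    have "2 * t * (A *v x) $ k = - (x \<bullet> (A *v x) + 1)"
      using nz by (simp add: t_def)
    then show False
      using quad[of x t] that by simp
  qed
  show "A' $ k $ j = 0"
  proof (cases "A $ k $ k = 0")
    case True
    then show ?thesis
      using zero[of "axis j 1"] by (simp add: A'_def matrix_vector_mult_basis column_def)
  qed (simp add: A'_def)
  have "(A' *v x) $ i = (A *v x) $ i - (A *v x) $ k / A $ k $ k * A $ i $ k" for i
    by (simp add: A'_def matrix_vector_mult_def left_diff_distrib right_diff_distrib sum_subtractf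
        sum_distrib_left sum_distrib_right sum_divide_distrib sym'[of i k] mult_ac)
  then have "A' *v x = A *v x - ((A *v x) $ k / A $ k $ k) *\<^sub>R (A $ k)"
    by (simp add: vec_eq_iff sym')
  then have "x \<bullet> (A' *v x) = x \<bullet> (A *v x) - ((A *v x) $ k)\<^sup>2 / A $ k $ k"
    by (simp add: inner_diff_right matrix_vector_mul_component inner_commute power2_eq_square)
  \<comment> \<open>For a nonzero pivot, this is the minimum over t of the quadratic in
    \<open>quad\<close>, attained at the t chosen here.\<close>
  also have "\<dots> \<ge> 0"
    using quad[of x "- (A *v x) $ k / A $ k $ k"] zero[of x]
    by (cases "A $ k $ k = 0") (simp_all add: power2_eq_square)
  finally show "0 \<le> x \<bullet> (A' *v x)" .
qed

text \<open>Eliminating k splits off a rank-one matrix and leaves a semidefinite one supported on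
  the smaller index set, to which the induction hypothesis applies.\<close>

lemma psd_factorization_on:
  fixes A :: "real ^ 'n ^ 'n"
  assumes "finite I" "transpose A = A" "\<And>x. 0 \<le> x \<bullet> (A *v x)" "\<And>i j. i \<notin> I \<Longrightarrow> A $ i $ j = 0"
  shows "\<exists>v. \<forall>i j. A $ i $ j = (\<Sum>k\<in>I. v k $ i * v k $ j :: real)"
  using assms
proof (induction I arbitrary: A)
  case empty
  then show ?case by simp
next
  case (insert k I)
  define A' where "A' = (\<chi> i j. A $ i $ j - A $ k $ i * A $ k $ j / A $ k $ k)"
  note step = Cholesky_step[OF insert.prems(1,2), where k = k, folded A'_def]
  have sym: "A $ i $ j = A $ j $ i" for i j
    using arg_cong[OF insert.prems(1), of "\<lambda>M. M $ j $ i"] by (simp add: transpose_def)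
  have "A' $ i $ j = 0" if "i \<notin> I" for i j
  proof (cases "i = k")
    case False
    then have "A $ i $ j = 0" "A $ k $ i = 0"
      using insert.prems(3)[of i] that sym[of k i] by auto
    then show ?thesis by (simp add: A'_def)
  qed (simp add: step)
  with insert.IH[OF step(2,3)]
  obtain v where v: "\<And>i j. A' $ i $ j = (\<Sum>l\<in>I. v l $ i * v l $ j)"
    by blast
  \<comment> \<open>The new vector is row k divided by the square root of the pivot; for a zero
    pivot, division by zero makes it 0, in agreement with \<open>A'\<close>.\<close>
  define w where "w = v(k := (\<chi> i. A $ k $ i / sqrt (A $ k $ k)))"
  have "A $ i $ j = (\<Sum>l\<in>insert k I. w l $ i * w l $ j)" for i j
  proof -
    have "(\<Sum>l\<in>I. w l $ i * w l $ j) = A' $ i $ j"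
      unfolding v by (rule sum.cong) (use insert.hyps in \<open>auto simp: w_def\<close>)
    moreover have "w k $ i * w k $ j = A $ k $ i * A $ k $ j / A $ k $ k"
      using step(1) by (simp add: w_def)
    ultimately show ?thesis
      using insert.hyps by (simp add: A'_def)
  qed
  then show ?case by blast
qed

lemma psd_factorization:
  fixes A :: "real ^ 'n ^ 'n"
  assumes "transpose A = A" "\<And>x. 0 \<le> x \<bullet> (A *v x)"
  obtains V :: "real ^ 'n ^ 'n" where "A = V ** transpose V"
proof -
  obtain v :: "'n \<Rightarrow> real ^ 'n" where "\<And>i j. A $ i $ j = (\<Sum>k\<in>UNIV. v k $ i * v k $ j)"
    using psd_factorization_on[of UNIV A] assms by auto
  then have "A = (\<chi> i k. v k $ i) ** transpose (\<chi> i k. v k $ i)"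
    by (simp add: vec_eq_iff matrix_matrix_mult_def transpose_def)
  then show ?thesis by (rule that)
qed

section \<open>The trace of the square of a skew matrix\<close>

lemma trace_congruence:
  fixes B W :: "real ^ 'n ^ 'n"
  shows "trace (transpose W ** (B ** W)) = (\<Sum>k\<in>UNIV. column k W \<bullet> (B *v column k W))"
  by (simp add: trace_def matrix_matrix_mult_def matrix_vector_mult_def transpose_def column_def
      inner_vec_def)

text \<open>Positivity makes S injective, hence invertible; substituting x = B y turns the form of B
  at y into the form of S at x.\<close>

lemma PD_inverse:
  fixes S :: "real ^ 'n ^ 'n"
  assumes "S \<in> PD"
  obtains B where "S ** B = mat 1" "\<And>y. y \<noteq> 0 \<Longrightarrow> 0 < y \<bullet> (B *v y)"
proof -
  have pos: "0 < x \<bullet> (S *v x)" if "x \<noteq> 0" for x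
    using assms that by (simp add: PD_def)
  have "\<forall>x. S *v x = 0 \<longrightarrow> x = 0"
    using pos by (metis inner_zero_right less_irrefl)
  then obtain B where "B ** S = mat 1"
    using matrix_left_invertible_ker[of S] by auto
  then have B: "S ** B = mat 1"
    by (simp add: matrix_left_right_inverse)
  have "0 < y \<bullet> (B *v y)" if "y \<noteq> 0" for y
  proof -
    have y: "S *v (B *v y) = y"
      by (simp add: matrix_vector_mul_assoc B)
    then have "B *v y \<noteq> 0" using that by auto
    from pos[OF this] show ?thesis by (simp add: y inner_commute)
  qed
  with B show ?thesis by (rule that)
qed

text \<open>With \<open>S = V V\<^sup>T\<close> and \<open>N S = - S N\<^sup>T\<close>, the trace of \<open>N\<^sup>2 = N N S S\<^sup>-\<^sup>1\<close> equals that of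
  \<open>- (N V)\<^sup>T S\<^sup>-\<^sup>1 (N V)\<close>.\<close>

lemma skew_trace_square_nonneg_imp_0:
  fixes N S :: "real ^ 'n ^ 'n"
  assumes S: "S \<in> PD" and skew: "N ** S + S ** transpose N = 0" and tr: "0 \<le> trace (N ** N)"
  shows "N = 0"
proof -
  obtain B where B: "S ** B = mat 1" "\<And>y. y \<noteq> 0 \<Longrightarrow> 0 < y \<bullet> (B *v y)"
    using PD_inverse[OF S] by blast
  have B_nonneg: "0 \<le> y \<bullet> (B *v y)" for y
    using B(2)[of y] by (cases "y = 0") auto
  have "transpose S = S"
    using S by (simp add: PD_def)
  moreover have "0 \<le> x \<bullet> (S *v x)" for x
    using S by (cases "x = 0") (auto simp: PD_def less_imp_le)
  ultimately obtain V :: "real ^ 'n ^ 'n" where V: "S = V ** transpose V"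
    by (rule psd_factorization)
  define W where "W = N ** V"
  have uminus: "X ** (- Y) = - (X ** Y)" "(- X) ** Y = - (X ** Y)" for X Y :: "real ^ 'n ^ 'n"
    by (simp_all add: vec_eq_iff matrix_matrix_mult_def sum_negf)
  have "N ** S = - (S ** transpose N)"
    using skew by (simp add: eq_neg_iff_add_eq_0)
  then have "N ** (N ** S) ** B = - ((N ** (S ** transpose N)) ** B)"
    by (simp add: uminus)
  also have "N ** (N ** S) ** B = N ** N"
    by (simp add: matrix_mul_assoc[symmetric] B)
  also have "(N ** (S ** transpose N)) ** B = W ** (transpose W ** B)"
    by (simp add: V W_def matrix_transpose_mul matrix_mul_assoc)
  finally have "trace (N ** N) = - trace (W ** (transpose W ** B))"
    by (simp add: trace_def sum_negf)
  also have "trace (W ** (transpose W ** B)) = trace (transpose W ** (B ** W))"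
    by (subst trace_mul_sym) (simp add: matrix_mul_assoc)
  finally have "(\<Sum>k\<in>UNIV. column k W \<bullet> (B *v column k W)) \<le> 0"
    using tr unfolding trace_congruence by simp
  then have "(\<Sum>k\<in>UNIV. column k W \<bullet> (B *v column k W)) = 0"
    by (intro antisym sum_nonneg B_nonneg)
  then have "\<forall>k\<in>UNIV. column k W \<bullet> (B *v column k W) = 0"
    by (subst (asm) sum_nonneg_eq_0_iff) (simp_all add: B_nonneg)
  then have "column k W = 0" for k
    using B(2)[of "column k W"] by force
  then have "W = 0"
    by (simp add: vec_eq_iff column_def)
  \<comment> \<open>N is recovered from W = N V, although V has not been shown to be
    invertible.\<close>
  have "N = N ** (S ** B)"
    by (simp add: B)
  also have "\<dots> = W ** (transpose V ** B)"
    by (simp add: V W_def matrix_mul_assoc)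
  finally show ?thesis
    by (simp add: \<open>W = 0\<close>)
qed

section \<open>Identifiability\<close>

lemma simple_digraph_trace_square_nonneg:
  assumes "simple_digraph E" "N \<in> edge_matrices E"
  shows "0 \<le> trace (N ** N)"
proof -
  have "0 \<le> N $ i $ j * N $ j $ i" for i j
  proof (cases "i = j")
    case False
    then have "(i, j) \<notin> E \<or> (j, i) \<notin> E"
      using assms(1) by (auto simp: simple_digraph_def)
    then show ?thesis
      using assms(2) by (auto simp: edge_matrices_def)
  qed simp
  then show ?thesis
    by (simp add: trace_def matrix_matrix_mult_def sum_nonneg)
qed

lemma self_mem_fiber: "M \<in> Stab E \<Longrightarrow> M \<in> fiber E C M"
  by (simp add: fiber_def)

lemma simple_imp_globally_identifiable:
  fixes E :: "('n::finite) rel"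
  assumes E: "simple_digraph E" and C: "C \<in> PD"
  shows "globally_identifiable E C"
proof -
  have "M = M0" if "M0 \<in> Stab E" "M \<in> fiber E C M0" for M M0
  proof -
    define S where "S = lyapunov_solution C M0"
    have M0: "stable_matrix M0" "M0 \<in> edge_matrices E" and M: "stable_matrix M" "M \<in> edge_matrices E"
      and "S = lyapunov_solution C M"
      using that by (auto simp: Stab_def fiber_def S_def)
    then have "M0 ** S + S ** transpose M0 + C = 0" "M ** S + S ** transpose M + C = 0"
      using lyapunov_solution[OF M0(1), of C] lyapunov_solution[OF M(1), of C] by (simp_all add: S_def)
    \<comment> \<open>Both matrices solve the equation with the same S, so C cancels in the
      difference.\<close>
    moreover have "(M - M0) ** S + S ** transpose (M - M0)
        = (M ** S + S ** transpose M + C) - (M0 ** S + S ** transpose M0 + C)"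
      by (simp add: vec_eq_iff matrix_matrix_mult_def transpose_def sum_subtractf algebra_simps)
    ultimately have "(M - M0) ** S + S ** transpose (M - M0) = 0"
      by (simp only: diff_self)
    moreover have "S \<in> PD"
      unfolding S_def by (rule lyapunov_solution_PD[OF M0(1) C])
    moreover have "M - M0 \<in> edge_matrices E"
      using M M0 by (simp add: edge_matrices_def)
    ultimately have "M - M0 = 0"
      using skew_trace_square_nonneg_imp_0 simple_digraph_trace_square_nonneg[OF E] by blast
    then show ?thesis by simp
  qed
  then show ?thesis
    unfolding globally_identifiable_def using self_mem_fiber by blast
qed

text \<open>The easy half of Lyapunov's theorem, for the solution \<open>S = I\<close>.\<close>

lemma stable_if_symmetric_part_neg:
  fixes M :: "real ^ 'n ^ 'n"
  assumes C: "C \<in> PD" and M: "M + transpose M + C = 0"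
  shows "stable_matrix M"
  unfolding stable_matrix_def
proof (intro allI impI)
  fix z assume "eigenvalue (map_matrix complex_of_real M) z"
  then obtain v where v: "v \<noteq> 0" "map_matrix complex_of_real M *v v = z *s v"
    by (auto simp: eigenvalue_def)
  define a b where "a = (\<chi> i. Re (v $ i))" and "b = (\<chi> i. Im (v $ i))"
  have comp: "(\<Sum>j\<in>UNIV. complex_of_real (M $ i $ j) * v $ j) = z * v $ i" for i
    using arg_cong[OF v(2), of "\<lambda>x. x $ i"] by (simp add: matrix_vector_mult_def)
  have "(M *v a) $ i = Re z * a $ i - Im z * b $ i" "(M *v b) $ i = Im z * a $ i + Re z * b $ i" for i
    using arg_cong[OF comp[of i], of Re] arg_cong[OF comp[of i], of Im]
    by (simp_all add: matrix_vector_mult_def a_def b_def)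
  then have Mab: "M *v a = Re z *\<^sub>R a - Im z *\<^sub>R b" "M *v b = Im z *\<^sub>R a + Re z *\<^sub>R b"
    by (simp_all add: vec_eq_iff)
  have quad: "2 * (x \<bullet> (M *v x)) = - (x \<bullet> (C *v x))" for x
  proof -
    have "x \<bullet> ((M + transpose M + C) *v x) = 0"
      by (simp add: M)
    moreover have "x \<bullet> (transpose M *v x) = x \<bullet> (M *v x)"
      by (subst inner_commute) (rule inner_transpose_mult)
    ultimately show ?thesis
      unfolding matrix_vector_mult_add_rdistrib inner_add_right by linarith
  qed
  \<comment> \<open>The cross terms with \<open>Im z\<close> cancel, so the sign of
    \<open>Re z\<close> is that of the form of M at the real and imaginary parts of v.\<close>
  have "a \<bullet> (M *v a) + b \<bullet> (M *v b) = Re z * (a \<bullet> a + b \<bullet> b)"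
    unfolding Mab by (simp add: inner_diff_right inner_add_right inner_commute algebra_simps)
  moreover have "a \<noteq> 0 \<or> b \<noteq> 0"
    using v(1) by (auto simp: a_def b_def vec_eq_iff complex_eq_iff)
  moreover have "x \<bullet> (M *v x) \<le> 0" "x \<noteq> 0 \<Longrightarrow> x \<bullet> (M *v x) < 0" for x
    using quad[of x] C by (cases "x = 0"; force simp: PD_def)+
  then have "a \<bullet> (M *v a) + b \<bullet> (M *v b) < 0"
    using \<open>a \<noteq> 0 \<or> b \<noteq> 0\<close> by (metis add_neg_nonpos add_nonpos_neg)
  ultimately have "Re z * (a \<bullet> a + b \<bullet> b) < 0" by simp
  then show "Re z < 0"
    by (metis add_nonneg_nonneg inner_ge_zero mult_nonneg_nonneg not_le)
qed

lemma globally_identifiable_imp_simple: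
  fixes E :: "('n::finite) rel"
  assumes loops: "all_self_loops E" and C: "C \<in> PD" "diagonal_matrix C"
    and ident: "globally_identifiable E C"
  shows "simple_digraph E"
proof (rule ccontr)
  assume "\<not> simple_digraph E"
  then obtain i j where ij: "i \<noteq> j" "(i, j) \<in> E" "(j, i) \<in> E"
    by (auto simp: simple_digraph_def)
  \<comment> \<open>K is skew-symmetric and supported on the 2-cycle, so every \<open>M t\<close>
    has symmetric part - C / 2.\<close>
  define K :: "real ^ 'n ^ 'n" where
    "K = (\<chi> a b. if a = i \<and> b = j then 1 else if a = j \<and> b = i then - 1 else 0)"
  define M :: "real \<Rightarrow> real ^ 'n ^ 'n" where "M t = t *\<^sub>R K - (1 / 2) *\<^sub>R C" for t
  have C_sym: "C $ a $ b = C $ b $ a" for a b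
    using C(1) by (auto simp: PD_def transpose_def vec_eq_iff)
  have lyap: "M t + transpose (M t) + C = 0" for t
    using ij(1) by (auto simp: M_def K_def vec_eq_iff transpose_def C_sym)
  then have stable: "stable_matrix (M t)" for t
    by (rule stable_if_symmetric_part_neg[OF C(1)])
  have edge: "M t \<in> edge_matrices E" for t
    unfolding edge_matrices_def
  proof (intro CollectI allI impI)
    fix a b assume "(a, b) \<notin> E"
    moreover from this have "a \<noteq> b"
      using loops by (auto simp: all_self_loops_def)
    \<comment> \<open>The self-loops accommodate the diagonal matrix C, and the two edges of the
      cycle accommodate K.\<close>
    ultimately show "M t $ b $ a = 0"
      using C(2) ij by (auto simp: M_def K_def diagonal_matrix_def)
  qed
  have "lyapunov_solution C (M t) = mat 1" for t
    using stable lyap by (intro lyapunov_solution_eq) simp_all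
  then have "M 1 \<in> fiber E C (M 0)" "M 0 \<in> Stab E"
    using stable edge by (simp_all add: fiber_def Stab_def)
  then have "M 1 = M 0"
    using ident by (auto simp: globally_identifiable_def)
  \<comment> \<open>The difference of the two matrices is K, whose entry here is 1.\<close>
  then have "M 1 $ i $ j = M 0 $ i $ j" by simp
  then show False
    by (simp add: M_def K_def)
qed

theorem theorem32:
  fixes E :: "('n::finite) rel"
  assumes "all_self_loops E"
  shows "(simple_digraph E \<longrightarrow> (\<forall>C \<in> PD. globally_identifiable E C)) \<and>
    (\<forall>C \<in> PD. diagonal_matrix C \<longrightarrow> (globally_identifiable E C \<longleftrightarrow> simple_digraph E))"
  using simple_imp_globally_identifiable globally_identifiable_imp_simple[OF assms] by blast

end
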